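(* Over the Steiner-Soddy porism of any number $N$ of sides, the locus of the perimeter centroid $C_1$ of the polygons $P$ is a conic.
   Context: Consider $N$ congruent circles centered at the vertices of a regular $N$-gon, consecutive ones being tangent. By symmetry, all of them are tangent to an inner circle and to an outer circle. The image of this configuration under inversion in a fixed circle is a Steiner chain: $N$ circles, consecutive ones tangent, all tangent to two fixed circles (the inner and outer Soddy circles, images of the two concentric circles). Rotating the regular $N$-gon about its center, with the inversion circle fixed, gives a one-parameter family of such chains with the same Soddy circles, called the Steiner porism. The Steiner-Soddy polygon $P$ is the $N$-gon whose consecutive vertices are the centers of the consecutive circles in the chain; the Steiner-Soddy porism (or family) is the family of these polygons over the Steiner porism. All polygons of the family are inscribed in one fixed conic and their sides are tangent to one fixed circle. The perimeter centroid $C_1$ of a polygon is the weighted average of the midpoints of its sides, where the weights are the sidelengths. *)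

theory Defs
  imports "HOL-Analysis.Analysis"
begin

definition inversion :: "complex \<Rightarrow> real \<Rightarrow> complex \<Rightarrow> complex" where
  "inversion A \<rho> z = A + (\<rho>\<^sup>2 / (dist z A)\<^sup>2) *\<^sub>R (z - A)"

definition circle_center :: "complex set \<Rightarrow> complex" where
  "circle_center S = (THE c. \<exists>s>0. S = sphere c s)"

lemma circle_center_sphere:
  assumes "s > 0"
  shows "circle_center (sphere c s) = c"
  unfolding circle_center_def
proof (rule the_equality)
  show "\<exists>t>0. sphere c s = sphere c t" using assms by blast
next
  fix c' assume "\<exists>t>0. sphere c s = sphere c' t"
  then obtain t where eq: "sphere c s = sphere c' t" by blast
  have *: "(cmod (c + w - c'))\<^sup>2 = t\<^sup>2" if "cmod w = s" for w
  proof -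
    have "c + w \<in> sphere c s" using that by (simp add: dist_norm)
    then have "dist c' (c + w) = t" unfolding eq by simp
    then show ?thesis by (simp add: dist_norm norm_minus_commute)
  qed
  have s: "cmod (of_real s) = s" "cmod (- of_real s) = s"
      "cmod (Complex 0 s) = s" "cmod (- Complex 0 s) = s"
    using assms by (simp_all add: cmod_def)
  have "(Re c + s - Re c')\<^sup>2 + (Im c - Im c')\<^sup>2 = t\<^sup>2"
      "(Re c - s - Re c')\<^sup>2 + (Im c - Im c')\<^sup>2 = t\<^sup>2"
      "(Re c - Re c')\<^sup>2 + (Im c + s - Im c')\<^sup>2 = t\<^sup>2"
      "(Re c - Re c')\<^sup>2 + (Im c - s - Im c')\<^sup>2 = t\<^sup>2"
    using *[OF s(1)] *[OF s(2)] *[OF s(3)] *[OF s(4)] unfolding cmod_power2 by simp_all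
  then have "s * (Re c - Re c') = 0" and "s * (Im c - Im c') = 0"
    by algebra+
  then show "c' = c" using assms by (simp add: complex_eq_iff)
qed

text \<open>
  Before inversion: \<open>N\<close> congruent circles centered at the vertices of the regular \<open>N\<close>-gon with
  center \<open>c\<close> and circumradius \<open>R\<close>, rotated by the angle \<open>\<theta>\<close>. Their common radius is half the side
  length, so that consecutive circles touch (see \<open>consecutive_tangent\<close>).
  All of them touch \<open>sphere c (R - r)\<close> and \<open>sphere c (R + r)\<close>, where \<open>r = chain_radius N R\<close>.
\<close>

definition regular_vertex :: "nat \<Rightarrow> complex \<Rightarrow> real \<Rightarrow> real \<Rightarrow> nat \<Rightarrow> complex" where
  "regular_vertex N c R \<theta> k = c + of_real R * cis (\<theta> + 2 * pi * real k / real N)"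

definition chain_radius :: "nat \<Rightarrow> real \<Rightarrow> real" where
  "chain_radius N R = R * sin (pi / real N)"

lemma consecutive_tangent:
  assumes "N \<ge> 3" and "R > 0"
  shows "dist (regular_vertex N c R \<theta> k) (regular_vertex N c R \<theta> (Suc k)) = 2 * chain_radius N R"
proof -
  define x where "x = \<theta> + 2 * pi * real k / real N"
  define h where "h = pi / real N"
  have h: "0 < sin h"
    using assms unfolding h_def by (intro sin_gt_zero) (auto simp: field_simps)
  have x: "\<theta> + 2 * pi * real (Suc k) / real N = x + 2 * h"
    using assms by (simp add: x_def h_def field_simps)
  have "(cmod (cis x - cis (x + 2 * h)))\<^sup>2 = 2 - 2 * cos (2 * h)"
  proof -
    have "(cos x - cos (x + 2 * h))\<^sup>2 + (sin x - sin (x + 2 * h))\<^sup>2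
        = ((cos x)\<^sup>2 + (sin x)\<^sup>2) + ((cos (x + 2 * h))\<^sup>2 + (sin (x + 2 * h))\<^sup>2)
          - 2 * (cos (x + 2 * h) * cos x + sin (x + 2 * h) * sin x)"
      by (simp add: power2_eq_square algebra_simps)
    also have "\<dots> = 2 - 2 * cos (x + 2 * h - x)"
      unfolding cos_diff[of "x + 2 * h" x] by simp
    finally show ?thesis by (simp add: cmod_power2)
  qed
  also have "\<dots> = (2 * sin h)\<^sup>2"
    by (simp add: cos_double_sin power_mult_distrib)
  finally have "cmod (cis x - cis (x + 2 * h)) = 2 * sin h"
    by (rule power2_eq_imp_eq) (use h in auto)
  moreover have "dist (regular_vertex N c R \<theta> k) (regular_vertex N c R \<theta> (Suc k))
      = cmod (of_real R * (cis x - cis (x + 2 * h)))"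
    unfolding regular_vertex_def x dist_norm x_def[symmetric] by (simp add: algebra_simps)
  ultimately show ?thesis
    using assms by (simp add: norm_mult chain_radius_def h_def)
qed

definition steiner_circle ::
    "nat \<Rightarrow> complex \<Rightarrow> real \<Rightarrow> complex \<Rightarrow> real \<Rightarrow> real \<Rightarrow> nat \<Rightarrow> complex set" where
  "steiner_circle N c R A \<rho> \<theta> k =
     inversion A \<rho> ` sphere (regular_vertex N c R \<theta> k) (chain_radius N R)"

text \<open>
  A polygon with \<open>N\<close> vertices is given by its vertex sequence \<open>P 0, \<dots>, P (N - 1)\<close>.
\<close>

definition steiner_soddy_polygon ::
    "nat \<Rightarrow> complex \<Rightarrow> real \<Rightarrow> complex \<Rightarrow> real \<Rightarrow> real \<Rightarrow> nat \<Rightarrow> complex" where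
  "steiner_soddy_polygon N c R A \<rho> \<theta> k = circle_center (steiner_circle N c R A \<rho> \<theta> k)"

definition perimeter_centroid :: "nat \<Rightarrow> (nat \<Rightarrow> complex) \<Rightarrow> complex" where
  "perimeter_centroid N P =
     (\<Sum>k<N. dist (P k) (P (Suc k mod N)) *\<^sub>R midpoint (P k) (P (Suc k mod N)))
       /\<^sub>R (\<Sum>k<N. dist (P k) (P (Suc k mod N)))"

definition perimeter_centroid_locus ::
    "nat \<Rightarrow> complex \<Rightarrow> real \<Rightarrow> complex \<Rightarrow> real \<Rightarrow> complex set" where
  "perimeter_centroid_locus N c R A \<rho> =
     range (\<lambda>\<theta>. perimeter_centroid N (steiner_soddy_polygon N c R A \<rho> \<theta>))"

definition quadratic_curve ::
    "real \<Rightarrow> real \<Rightarrow> real \<Rightarrow> real \<Rightarrow> real \<Rightarrow> real \<Rightarrow> complex set" where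
  "quadratic_curve a b d e f g =
     {z. a * (Re z)\<^sup>2 + 2 * b * Re z * Im z + d * (Im z)\<^sup>2 + 2 * e * Re z + 2 * f * Im z + g = 0}"

text \<open>
  A conic is the nonempty zero set of a real polynomial of degree exactly two in two variables;
  degenerate conics such as points are included. It is nondegenerate if the symmetric matrix of
  the homogenized polynomial can be taken invertible (this forces degree two).
\<close>

definition conic :: "complex set \<Rightarrow> bool" where
  "conic S \<longleftrightarrow> S \<noteq> {} \<and>
     (\<exists>a b d e f g. (a, b, d) \<noteq> (0, 0, 0) \<and> S = quadratic_curve a b d e f g)"

definition nondegenerate_conic :: "complex set \<Rightarrow> bool" where
  "nondegenerate_conic S \<longleftrightarrow> S \<noteq> {} \<and>
     (\<exists>a b d e f g.
        det (vector [vector [a, b, e], vector [b, d, f], vector [e, f, g]] :: real^3^3) \<noteq> 0 \<and>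
        S = quadratic_curve a b d e f g)"

end

theory Submission
  imports Defs
begin

text \<open>
  Write \<open>v\<^sub>k\<close> for the vertices of the regular polygon, \<open>r\<close> for the radius of the congruent circles,
  \<open>u\<^sub>k = v\<^sub>k - A\<close> and \<open>p\<^sub>k = \<bar>u\<^sub>k\<bar>\<^sup>2 - r\<^sup>2\<close> for the power of the center of inversion \<open>A\<close> with respect to
  the circle around \<open>v\<^sub>k\<close>. The condition on \<open>A\<close> makes all these powers positive. The \<open>k\<close>-th
  circle of the chain then has center \<open>A + (\<rho>\<^sup>2 / p\<^sub>k) u\<^sub>k\<close> and radius \<open>\<rho>\<^sup>2 r / p\<^sub>k\<close>, and consecutive
  circles of the chain touch externally, so a side of the polygon has length
  \<open>\<rho>\<^sup>2 r (1 / p\<^sub>k + 1 / p\<^sub>k\<^sub>+\<^sub>1)\<close> and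
  \<open>C\<^sub>1 = A + \<rho>\<^sup>2 / 4 \<cdot> (2 \<Sum> u\<^sub>k / p\<^sub>k\<^sup>2 + \<Sum> (u\<^sub>k + u\<^sub>k\<^sub>+\<^sub>1) / (p\<^sub>k p\<^sub>k\<^sub>+\<^sub>1)) / (\<Sum> 1 / p\<^sub>k)\<close>
  (\<open>perimeter_centroid_steiner_soddy\<close>).

  Suppose \<open>A \<noteq> c\<close> and turn the picture so that \<open>A - c = d > 0\<close>. Then \<open>p\<^sub>k\<close> is a positive multiple of
  \<open>\<bar>1 - s z\<^sub>k\<bar>\<^sup>2\<close> for some \<open>0 < s < 1\<close> and the points \<open>z\<^sub>k\<close> of a regular polygon inscribed in the unit circle.
  Averages of rational functions over these points depend only on \<open>Z = z\<^sub>k\<^sup>N\<close>: both \<open>\<Sum> 1 / p\<^sub>k\<close> and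
  \<open>\<Sum> u\<^sub>k / p\<^sub>k\<^sup>2\<close> follow from \<open>\<Sum> 1 / (1 - x z\<^sub>k) = N / (1 - x\<^sup>N Z)\<close> and its derivative in \<open>x\<close>
  (\<open>sum_poisson\<close>, \<open>sum_blaschke\<close>, \<open>sum_square_terms\<close>). In the mixed sum everything telescopes
  except a constant multiple of \<open>\<Sum> 1 / p\<^sub>k\<close> (\<open>sum_consecutive_products\<close>, \<open>sum_mixed_terms\<close>).
  With \<open>q = s\<^sup>N\<close> and the Blaschke factor \<open>b = (Z - q) / (1 - q Z)\<close> the outcome is
  \<open>C\<^sub>1 = const + X Re b + \<i> Y Im b\<close> with constants \<open>X\<close> and \<open>Y\<close> (\<open>perimeter_centroid_blaschke\<close>).
  Here \<open>X\<close> is a nonzero multiple of \<open>R\<^sup>2 - r\<^sup>2 - d\<^sup>2\<close>, which cannot vanish because \<open>A\<close> is inside the inner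
  or outside the outer circle, and \<open>Y\<close> is visibly nonzero. As the polygon turns, \<open>b\<close> runs through
  the whole unit circle, so the locus is an ellipse. If \<open>A = c\<close>, every
  polygon is regular with center \<open>c\<close>, and the locus is the point \<open>c\<close>.
\<close>

section \<open>Inversion of circles\<close>

text \<open>
  A form of Stewart's theorem. It reduces distances between images under inversion to
  distances from the center of inversion and distances between the original points.
\<close>

lemma norm_scaled_diff_squared:
  fixes x y :: "'a::real_inner"
  shows "(norm (a *\<^sub>R x - b *\<^sub>R y))\<^sup>2
    = a * (a - b) * (norm x)\<^sup>2 + b * (b - a) * (norm y)\<^sup>2 + a * b * (norm (x - y))\<^sup>2"
  unfolding power2_norm_eq_inner
  by (simp add: inner_diff_left inner_diff_right inner_commute[of y x]
      algebra_simps power2_eq_square)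

lemma inversion_involution:
  assumes "\<rho> > 0" and "z \<noteq> A"
  shows "inversion A \<rho> (inversion A \<rho> z) = z"
proof -
  have "dist z A > 0" using assms by simp
  have "dist (inversion A \<rho> z) A = \<rho>\<^sup>2 / dist z A"
    using \<open>dist z A > 0\<close> by (simp add: inversion_def dist_norm power2_eq_square)
  then show ?thesis
    using assms \<open>dist z A > 0\<close>
    unfolding inversion_def[of A \<rho> "inversion A \<rho> z"]
    by (simp add: inversion_def power2_eq_square)
qed

lemma inversion_maps_sphere:
  assumes p: "p = (dist v A)\<^sup>2 - r\<^sup>2" "p > 0" and "r > 0" and z: "z \<in> sphere v r"
  shows "inversion A \<rho> z \<in> sphere (A + (\<rho>\<^sup>2 / p) *\<^sub>R (v - A)) (\<rho>\<^sup>2 * r / p)"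
proof -
  have zA: "z \<noteq> A"
    using p z by (auto simp: dist_commute)
  define m where "m = (norm (z - A))\<^sup>2"
  have m: "m > 0" using zA by (simp add: m_def)
  have v: "(norm (v - A))\<^sup>2 = p + r\<^sup>2" using p by (simp add: dist_norm)
  have d: "norm (z - A - (v - A)) = r"
    using z by (simp add: dist_norm norm_minus_commute)
  have "(norm ((\<rho>\<^sup>2 / m) *\<^sub>R (z - A) - (\<rho>\<^sup>2 / p) *\<^sub>R (v - A)))\<^sup>2 = (\<rho>\<^sup>2 * r / p)\<^sup>2"
    unfolding norm_scaled_diff_squared v d m_def[symmetric] using m p(2)
    by (simp add: field_simps power2_eq_square)
  then have "norm ((\<rho>\<^sup>2 / m) *\<^sub>R (z - A) - (\<rho>\<^sup>2 / p) *\<^sub>R (v - A)) = \<rho>\<^sup>2 * r / p"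
    by (rule power2_eq_imp_eq) (use p(2) \<open>r > 0\<close> in auto)
  then show ?thesis
    by (simp add: inversion_def m_def dist_norm norm_minus_commute)
qed

text \<open>
  The image circle has the positive power \<open>\<rho>\<^sup>4 / p\<close> with respect to \<open>A\<close>, and the formulas for its
  center and radius, applied to itself, give back \<open>v\<close> and \<open>r\<close>. As inversion is an involution, the inclusion
  of \<open>inversion_maps_sphere\<close> for the image circle is the reverse inclusion.
\<close>

lemma inversion_image_sphere:
  assumes p: "p = (dist v A)\<^sup>2 - r\<^sup>2" "p > 0" and "r > 0" "\<rho> > 0"
  shows "inversion A \<rho> ` sphere v r = sphere (A + (\<rho>\<^sup>2 / p) *\<^sub>R (v - A)) (\<rho>\<^sup>2 * r / p)"
    (is "_ = sphere ?v ?r")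
proof
  show "inversion A \<rho> ` sphere v r \<subseteq> sphere ?v ?r"
    using inversion_maps_sphere assms by blast
  have r: "?r > 0" using assms by simp
  have p': "\<rho>^4 / p = (dist ?v A)\<^sup>2 - ?r\<^sup>2"
  proof -
    have "(dist ?v A)\<^sup>2 = (\<rho>\<^sup>2 / p)\<^sup>2 * (dist v A)\<^sup>2"
      by (simp add: dist_norm power_mult_distrib power_divide)
    also have "(dist v A)\<^sup>2 = p + r\<^sup>2" using p by simp
    finally show ?thesis using p(2) by (simp add: field_simps power2_eq_square power4_eq_xxxx)
  qed
  have back_again: "A + (\<rho>\<^sup>2 / (\<rho>^4 / p)) *\<^sub>R (?v - A) = v" "\<rho>\<^sup>2 * ?r / (\<rho>^4 / p) = r"
    using assms(2,4) by (simp_all add: power2_eq_square power4_eq_xxxx)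
  show "sphere ?v ?r \<subseteq> inversion A \<rho> ` sphere v r"
  proof
    fix y assume y: "y \<in> sphere ?v ?r"
    have yA: "y \<noteq> A"
    proof
      assume "y = A"
      then have "(dist ?v A)\<^sup>2 = ?r\<^sup>2" using y by simp
      moreover have "\<rho>^4 / p > 0" using assms by simp
      ultimately show False using p' by simp
    qed
    have "inversion A \<rho> y \<in> sphere v r"
      using inversion_maps_sphere[OF p' _ r y, of \<rho>] assms unfolding back_again by simp
    then show "y \<in> inversion A \<rho> ` sphere v r"
      using inversion_involution[OF assms(4) yA] by (metis imageI)
  qed
qed

text \<open>
  The distance is the sum of the two image radii: when \<open>A\<close> is outside both circles, external
  tangency survives the inversion.
\<close>

lemma inverted_tangent_circles:
  fixes u v :: complex
  assumes p: "p = (norm u)\<^sup>2 - r\<^sup>2" "p > 0" and q: "q = (norm v)\<^sup>2 - r\<^sup>2" "q > 0"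
    and tangent: "norm (u - v) = 2 * r" and "r > 0"
  shows "dist (A + (\<rho>\<^sup>2 / p) *\<^sub>R u) (A + (\<rho>\<^sup>2 / q) *\<^sub>R v) = \<rho>\<^sup>2 * r * (1 / p + 1 / q)"
proof -
  have n: "(norm u)\<^sup>2 = p + r\<^sup>2" "(norm v)\<^sup>2 = q + r\<^sup>2" using p q by auto
  have "(norm ((\<rho>\<^sup>2 / p) *\<^sub>R u - (\<rho>\<^sup>2 / q) *\<^sub>R v))\<^sup>2 = (\<rho>\<^sup>2 * r * (1 / p + 1 / q))\<^sup>2"
    unfolding norm_scaled_diff_squared n tangent using p(2) q(2)
    by (simp add: field_simps power2_eq_square)
  then have "norm ((\<rho>\<^sup>2 / p) *\<^sub>R u - (\<rho>\<^sup>2 / q) *\<^sub>R v) = \<rho>\<^sup>2 * r * (1 / p + 1 / q)"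
    by (rule power2_eq_imp_eq) (use p(2) q(2) \<open>r > 0\<close> in auto)
  then show ?thesis by (simp add: dist_norm)
qed

section \<open>Sums over the vertices of a regular polygon\<close>

definition vertex_angle :: "nat \<Rightarrow> real \<Rightarrow> nat \<Rightarrow> real" where
  "vertex_angle N t k = t + 2 * pi * real k / real N"

lemma vertex_angle_Suc: "vertex_angle N t (Suc k) = vertex_angle N t k + 2 * (pi / real N)"
  by (simp add: vertex_angle_def add_divide_distrib algebra_simps)

lemma cis_vertex_angle_period: "N > 0 \<Longrightarrow> cis (vertex_angle N t N) = cis (vertex_angle N t 0)"
  by (simp add: vertex_angle_def flip: cis_mult)

lemma sum_cyclic_shift:
  fixes f :: "nat \<Rightarrow> 'a::ab_group_add"
  assumes "f N = f 0"
  shows "(\<Sum>k<N. f (Suc k)) = (\<Sum>k<N. f k)"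
  using sum.lessThan_Suc_shift[of f N] assms by simp

lemma cis_vertex_angle_power: "N > 0 \<Longrightarrow> cis (vertex_angle N t k) ^ N = cis (real N * t)"
proof -
  assume "N > 0"
  then have "real N * vertex_angle N t k = real N * t + 2 * pi * of_nat k"
    by (simp add: vertex_angle_def field_simps)
  then show ?thesis
    by (simp add: Complex.DeMoivre flip: cis_mult)
qed

lemma sum_vertex_angle_powers:
  assumes "0 < j" "j < N"
  shows "(\<Sum>k<N. cis (vertex_angle N t k) ^ j) = 0"
proof -
  define w where "w = cis (2 * pi * real j / real N)"
  have "cis (vertex_angle N t k) ^ j = cis (real j * t) * w ^ k" for k
    by (simp add: w_def Complex.DeMoivre cis_mult vertex_angle_def algebra_simps)
  then have "(\<Sum>k<N. cis (vertex_angle N t k) ^ j) = cis (real j * t) * (\<Sum>k<N. w ^ k)"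
    by (simp add: sum_distrib_left)
  moreover have "w \<noteq> 1"
  proof
    assume "w = 1"
    then have "cos (2 * (pi * real j / real N)) = 1"
      by (simp add: w_def complex_eq_iff mult.assoc)
    then have "sin (pi * real j / real N) = 0" by (simp only: cos_double_sin) simp
    moreover have "sin (pi * real j / real N) > 0"
      using assms by (intro sin_gt_zero) (auto simp: field_simps)
    ultimately show False by simp
  qed
  moreover have "w ^ N = 1"
    using assms by (simp add: w_def Complex.DeMoivre)
  ultimately show ?thesis by (simp add: geometric_sum)
qed

text \<open>
  Expanding the geometric series up to the power \<open>N\<close> gives each term the common denominator
  \<open>1 - x\<^sup>N z\<^sub>k\<^sup>N\<close>, and in the numerators only the constant term survives summation over the polygon.
\<close>

lemma sum_vertex_angle_resolvent:
  fixes x :: complex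
  assumes "N > 0" and x: "norm x < 1"
  shows "(\<Sum>k<N. 1 / (1 - x * cis (vertex_angle N t k))) = of_nat N / (1 - x ^ N * cis (real N * t))"
proof -
  define W where "W = 1 - x ^ N * cis (real N * t)"
  have "norm (x ^ N) < 1"
    using x assms(1) by (simp add: norm_power power_less_one_iff)
  then have "norm (x ^ N * cis (real N * t)) < 1" by (simp add: norm_mult)
  then have W: "W \<noteq> 0" unfolding W_def by force
  have expand: "1 / (1 - x * cis (vertex_angle N t k)) = (\<Sum>j<N. x ^ j * cis (vertex_angle N t k) ^ j) / W" for k
  proof -
    have "norm (x * cis (vertex_angle N t k)) < 1" using x by (simp add: norm_mult)
    then have nz: "1 - x * cis (vertex_angle N t k) \<noteq> 0" by force
    have "(1 - x * cis (vertex_angle N t k)) * (\<Sum>j<N. (x * cis (vertex_angle N t k)) ^ j) = W"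
      by (simp only: one_diff_power_eq[symmetric] W_def) (simp add: power_mult_distrib
        cis_vertex_angle_power[OF assms(1)])
    then show ?thesis using nz W by (simp add: field_simps power_mult_distrib)
  qed
  have "(\<Sum>k<N. 1 / (1 - x * cis (vertex_angle N t k)))
      = (\<Sum>j<N. x ^ j * (\<Sum>k<N. cis (vertex_angle N t k) ^ j)) / W"
    unfolding expand sum_divide_distrib[symmetric] sum_distrib_left
    by (subst sum.swap) simp
  also have "(\<Sum>j<N. x ^ j * (\<Sum>k<N. cis (vertex_angle N t k) ^ j)) = (\<Sum>j<N. if j = 0 then of_nat N else 0)"
    by (intro sum.cong) (auto simp: sum_vertex_angle_powers)
  also have "\<dots> = of_nat N" using assms(1) by simp
  finally show ?thesis by (simp add: W_def)
qed

lemma sum_vertex_angle_resolvent_deriv: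
  fixes x :: complex
  assumes "N > 0" and x: "norm x < 1"
  shows "(\<Sum>k<N. cis (vertex_angle N t k) / (1 - x * cis (vertex_angle N t k))\<^sup>2)
    = (of_nat N)\<^sup>2 * x ^ (N - 1) * cis (real N * t) / (1 - x ^ N * cis (real N * t))\<^sup>2"
proof -
  have nz: "1 - x * cis (vertex_angle N t k) \<noteq> 0" for k
  proof -
    have "norm (x * cis (vertex_angle N t k)) < 1" using x by (simp add: norm_mult)
    then show ?thesis by force
  qed
  have nz': "1 - x ^ N * cis (real N * t) \<noteq> 0"
  proof -
    have "norm (x ^ N * cis (real N * t)) < 1"
      using x assms(1) by (simp add: norm_mult norm_power power_less_one_iff)
    then show ?thesis by force
  qed
  have left: "((\<lambda>x. \<Sum>k<N. 1 / (1 - x * cis (vertex_angle N t k))) has_field_derivative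
      (\<Sum>k<N. cis (vertex_angle N t k) / (1 - x * cis (vertex_angle N t k))\<^sup>2)) (at x)"
    by (rule DERIV_sum)
      (use nz in \<open>fastforce intro!: derivative_eq_intros simp: power2_eq_square\<close>)
  have "((\<lambda>x. of_nat N / (1 - x ^ N * cis (real N * t))) has_field_derivative
      (of_nat N)\<^sup>2 * x ^ (N - 1) * cis (real N * t) / (1 - x ^ N * cis (real N * t))\<^sup>2) (at x)"
    using nz' by (auto intro!: derivative_eq_intros simp: power2_eq_square)
  then have "((\<lambda>x. \<Sum>k<N. 1 / (1 - x * cis (vertex_angle N t k))) has_field_derivative
      (of_nat N)\<^sup>2 * x ^ (N - 1) * cis (real N * t) / (1 - x ^ N * cis (real N * t))\<^sup>2) (at x)"
    by (rule has_field_derivative_transform_within_open[where S = "ball 0 1"])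
      (use assms in \<open>auto simp: sum_vertex_angle_resolvent\<close>)
  then show ?thesis using left DERIV_unique by blast
qed

section \<open>Poisson kernels and Blaschke factors\<close>

text \<open>
  This is \<open>\<bar>1 - s e\<^sup>i\<^sup>x\<bar>\<^sup>2\<close>, the denominator of the Poisson kernel \<open>(1 - s\<^sup>2) / (1 + s\<^sup>2 - 2 s cos x)\<close>
  of the unit disc.
\<close>

definition poisson_denom :: "real \<Rightarrow> real \<Rightarrow> real" where
  "poisson_denom s x = 1 + s\<^sup>2 - 2 * s * cos x"

definition blaschke :: "real \<Rightarrow> complex \<Rightarrow> complex" where
  "blaschke s z = (z - of_real s) / (1 - of_real s * z)"

lemma poisson_denom_norm: "poisson_denom s x = (norm (1 - of_real s * cis x))\<^sup>2"
proof -
  have "(norm (1 - of_real s * cis x))\<^sup>2 = 1 - 2 * s * cos x + s\<^sup>2 * ((sin x)\<^sup>2 + (cos x)\<^sup>2)"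
    unfolding cmod_power2 by (simp add: power2_eq_square algebra_simps del: sin_cos_squared_add3)
  then show ?thesis by (simp add: poisson_denom_def)
qed

lemma one_minus_scaled_cis_nonzero:
  assumes "\<bar>s\<bar> < 1"
  shows "1 - of_real s * cis x \<noteq> 0"
proof -
  have "norm (of_real s * cis x) < 1" using assms by (simp add: norm_mult)
  then show ?thesis by force
qed

lemma poisson_denom_pos: "\<bar>s\<bar> < 1 \<Longrightarrow> poisson_denom s x > 0"
  using one_minus_scaled_cis_nonzero by (simp add: poisson_denom_norm)

lemma poisson_denom_factor:
  "of_real (poisson_denom s x) = (1 - of_real s * cis x) * (1 - of_real s * cis (- x))"
proof -
  have "cis (- x) = cnj (cis x)" by (simp add: cis_cnj)
  then show ?thesis
    unfolding poisson_denom_norm complex_norm_square by simp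
qed

lemma blaschke_cis:
  assumes "\<bar>s\<bar> < 1"
  shows "of_real (poisson_denom s x) * blaschke s (cis x)
    = Complex ((1 + s\<^sup>2) * cos x - 2 * s) ((1 - s\<^sup>2) * sin x)"
proof -
  have "of_real (poisson_denom s x) * blaschke s (cis x)
      = (cis x - of_real s) * (1 - of_real s * cis (- x))"
    using one_minus_scaled_cis_nonzero[OF assms, of x]
    by (simp add: poisson_denom_factor blaschke_def)
  also have "\<dots> = cis x - 2 * of_real s + of_real (s\<^sup>2) * cis (- x)"
    by (simp add: algebra_simps cis_mult power2_eq_square)
  also have "\<dots> = Complex ((1 + s\<^sup>2) * cos x - 2 * s) ((1 - s\<^sup>2) * sin x)"
    by (simp add: complex_eq_iff algebra_simps)
  finally show ?thesis .
qed

text \<open>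
  This links the terms of \<open>sum_vertex_angle_resolvent_deriv\<close> to Blaschke factors. It is used for
  the single vertices with \<open>s\<close> and for the total with \<open>s\<^sup>N\<close>, so that a sum of Blaschke factors over
  Poisson denominators is again of this shape.
\<close>

lemma blaschke_over_denom:
  assumes "\<bar>s\<bar> < 1"
  shows "cis x / (1 - of_real s * cis x)\<^sup>2 = blaschke s (cis x) / of_real (poisson_denom s x)"
proof -
  have nz: "1 - of_real s * cis x \<noteq> 0" "1 - of_real s * cis (- x) \<noteq> 0"
    using one_minus_scaled_cis_nonzero[OF assms] by auto
  have "cis x * (1 - of_real s * cis (- x)) = cis x - of_real s"
    by (simp add: algebra_simps cis_mult)
  then have "cis x / (1 - of_real s * cis x)\<^sup>2
      = (cis x - of_real s) / ((1 - of_real s * cis x) * ((1 - of_real s * cis x) * (1 - of_real s * cis (- x))))"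
    using nz by (simp add: divide_simps power2_eq_square)
  then show ?thesis by (simp add: poisson_denom_factor blaschke_def)
qed

lemma inverse_poisson_denom:
  assumes "\<bar>s\<bar> < 1"
  shows "(1 - s\<^sup>2) / poisson_denom s x = 2 * Re (1 / (1 - of_real s * cis x)) - 1"
proof -
  have "Re (1 / (1 - of_real s * cis x)) = (1 - s * cos x) / poisson_denom s x"
    by (simp add: Re_divide poisson_denom_norm cmod_power2)
  then show ?thesis using poisson_denom_pos[OF assms, of x]
    by (simp add: field_simps) (simp add: poisson_denom_def)
qed

text \<open>
  The average of the Poisson kernel over a regular \<open>N\<close>-gon is the Poisson kernel with parameter \<open>s\<^sup>N\<close>
  at the angle \<open>N t\<close>.
\<close>

lemma sum_poisson:
  assumes "N > 0" "\<bar>s\<bar> < 1"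
  shows "(\<Sum>k<N. 1 / poisson_denom s (vertex_angle N t k))
    = real N * (1 - (s^N)\<^sup>2) / ((1 - s\<^sup>2) * poisson_denom (s^N) (real N * t))"
proof -
  have sN: "\<bar>s ^ N\<bar> < 1" using assms by (simp add: power_abs power_less_one_iff)
  have s2: "1 - s\<^sup>2 > 0" using assms(2) by (simp add: abs_square_less_1)
  have "(1 - s\<^sup>2) * (\<Sum>k<N. 1 / poisson_denom s (vertex_angle N t k))
      = (\<Sum>k<N. 2 * Re (1 / (1 - of_real s * cis (vertex_angle N t k))) - 1)"
    by (simp add: sum_distrib_left inverse_poisson_denom[OF assms(2), symmetric])
  also have "\<dots> = 2 * Re (\<Sum>k<N. 1 / (1 - of_real s * cis (vertex_angle N t k))) - real N"
    by (simp add: sum_subtractf sum_distrib_left)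
  also have "\<dots> = real N * (2 * Re (1 / (1 - of_real (s^N) * cis (real N * t))) - 1)"
    using assms by (subst sum_vertex_angle_resolvent)
      (auto simp: algebra_simps Re_divide)
  also have "\<dots> = real N * ((1 - (s^N)\<^sup>2) / poisson_denom (s^N) (real N * t))"
    by (simp only: inverse_poisson_denom[OF sN])
  finally show ?thesis using s2 poisson_denom_pos[OF sN, of "real N * t"]
    by (simp add: eq_divide_eq mult_ac)
qed

lemma sum_blaschke:
  assumes "N > 0" "\<bar>s\<bar> < 1"
  shows "(\<Sum>k<N. blaschke s (cis (vertex_angle N t k)) / of_real (poisson_denom s (vertex_angle N t k)))
    = of_real ((real N)\<^sup>2 * s ^ (N - 1) / poisson_denom (s^N) (real N * t))
      * blaschke (s^N) (cis (real N * t))"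
proof -
  have sN: "\<bar>s ^ N\<bar> < 1" using assms by (simp add: power_abs power_less_one_iff)
  show ?thesis
    using sum_vertex_angle_resolvent_deriv[of N "of_real s" t] assms
      arg_cong[OF blaschke_over_denom[OF sN, of "real N * t"],
        of "(*) ((of_nat N)\<^sup>2 * of_real s ^ (N - 1))"]
    by (simp add: blaschke_over_denom mult.assoc)
qed

text \<open>
  For a Blaschke factor \<open>b\<close> over its Poisson denominator \<open>n\<close>, the imaginary part gives the terms
  \<open>sin x / n\<^sup>2\<close>, and the real part gives \<open>1 / n\<^sup>2\<close> in the next lemma. Real and imaginary parts of the
  perimeter centroid are built from these terms.
\<close>

lemma sin_over_poisson_denom_squared:
  assumes "\<bar>s\<bar> < 1"
  shows "(1 - s\<^sup>2) * (sin x / (poisson_denom s x)\<^sup>2)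
    = Im (blaschke s (cis x) / of_real (poisson_denom s x))"
proof -
  have im: "poisson_denom s x * Im (blaschke s (cis x)) = (1 - s\<^sup>2) * sin x"
    using arg_cong[OF blaschke_cis[OF assms, of x], of Im] by simp
  then show ?thesis
    unfolding times_divide_eq_right im[symmetric]
    using poisson_denom_pos[OF assms, of x] by (simp add: power2_eq_square)
qed

lemma inverse_poisson_denom_squared:
  assumes "\<bar>s\<bar> < 1"
  shows "(1 - s\<^sup>2)\<^sup>2 / (poisson_denom s x)\<^sup>2
    = 2 * s * Re (blaschke s (cis x) / of_real (poisson_denom s x))
      + (1 + s\<^sup>2) * (1 / poisson_denom s x)"
proof -
  have b: "poisson_denom s x * Re (blaschke s (cis x)) = (1 + s\<^sup>2) * cos x - 2 * s"
    using arg_cong[OF blaschke_cis[OF assms, of x], of Re] by simp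
  have "2 * s * ((1 + s\<^sup>2) * cos x - 2 * s) + (1 + s\<^sup>2) * poisson_denom s x = (1 - s\<^sup>2)\<^sup>2"
    by (simp add: poisson_denom_def power2_eq_square algebra_simps)
  then show ?thesis unfolding b[symmetric]
    using poisson_denom_pos[OF assms, of x] by (simp add: field_simps power2_eq_square)
qed

section \<open>The sums in the perimeter centroid\<close>

text \<open>
  With \<open>h = \<pi> / N\<close> and \<open>\<phi>\<close> the angle midway between two consecutive vertices, the combination
  \<open>\<alpha> sin h (p\<^sub>k + p\<^sub>k\<^sub>+\<^sub>1) + \<beta> cos h (sin (\<phi> + h) p\<^sub>k - sin (\<phi> - h) p\<^sub>k\<^sub>+\<^sub>1)\<close> does not depend on \<open>\<phi>\<close>:
  the coefficients are chosen to cancel \<open>cos \<phi>\<close>. Dividing by \<open>p\<^sub>k p\<^sub>k\<^sub>+\<^sub>1\<close> writes its reciprocal as a combination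
  of \<open>1 / p\<^sub>k\<close>, \<open>1 / p\<^sub>k\<^sub>+\<^sub>1\<close> and a telescoping difference.
\<close>

lemma sum_consecutive_products:
  fixes \<alpha> \<beta> t :: real and N :: nat
  defines "p \<equiv> \<lambda>k. \<alpha> - \<beta> * cos (vertex_angle N t k)" and "h \<equiv> pi / real N"
  assumes "N \<ge> 2" and pos: "\<And>k. p k > 0"
  shows "(\<alpha>\<^sup>2 - \<beta>\<^sup>2 * (cos h)\<^sup>2) * (\<Sum>k<N. 1 / (p k * p (Suc k))) = \<alpha> * (\<Sum>k<N. 1 / p k)"
proof -
  define f where "f k = sin (vertex_angle N t k) / p k" for k
  have h: "sin h > 0"
    using assms(3) unfolding h_def by (intro sin_gt_zero) (auto simp: field_simps)
  have per: "cos (vertex_angle N t N) = cos (vertex_angle N t 0)" "sin (vertex_angle N t N) = sin (vertex_angle N t 0)"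
    using cis_vertex_angle_period[of N t] assms(3) by (auto simp: complex_eq_iff)
  have step: "2 * sin h * ((\<alpha>\<^sup>2 - \<beta>\<^sup>2 * (cos h)\<^sup>2) * (1 / (p k * p (Suc k))))
      = \<alpha> * sin h * (1 / p k + 1 / p (Suc k)) + \<beta> * cos h * (f (Suc k) - f k)" for k
  proof -
    define \<phi> where "\<phi> = vertex_angle N t k + h"
    have x: "vertex_angle N t k = \<phi> - h" "vertex_angle N t (Suc k) = \<phi> + h"
      by (simp_all add: \<phi>_def vertex_angle_Suc h_def)
    have "2 * sin h * (\<alpha>\<^sup>2 - \<beta>\<^sup>2 * (cos h)\<^sup>2)
        = \<alpha> * sin h * (p (Suc k) + p k)
          + \<beta> * cos h * (sin (\<phi> + h) * p k - sin (\<phi> - h) * p (Suc k))"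
      unfolding p_def x cos_add cos_diff sin_add sin_diff using sin_cos_squared_add[of \<phi>]
      by algebra
    then have "2 * sin h * ((\<alpha>\<^sup>2 - \<beta>\<^sup>2 * (cos h)\<^sup>2) * (1 / (p k * p (Suc k))))
        = (\<alpha> * sin h * (p (Suc k) + p k)
          + \<beta> * cos h * (sin (\<phi> + h) * p k - sin (\<phi> - h) * p (Suc k))) / (p k * p (Suc k))"
      by simp
    also have "\<dots> = \<alpha> * sin h * (1 / p k + 1 / p (Suc k)) + \<beta> * cos h * (f (Suc k) - f k)"
      using pos[of k] pos[of "Suc k"] by (simp add: f_def x[symmetric] field_simps)
    finally show ?thesis .
  qed
  have "2 * sin h * ((\<alpha>\<^sup>2 - \<beta>\<^sup>2 * (cos h)\<^sup>2) * (\<Sum>k<N. 1 / (p k * p (Suc k))))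
      = \<alpha> * sin h * ((\<Sum>k<N. 1 / p k) + (\<Sum>k<N. 1 / p (Suc k)))
        + \<beta> * cos h * ((\<Sum>k<N. f (Suc k)) - (\<Sum>k<N. f k))"
    unfolding sum_distrib_left step by (simp add: sum.distrib sum_subtractf sum_distrib_left algebra_simps)
  also have "(\<Sum>k<N. f (Suc k)) = (\<Sum>k<N. f k)"
    by (rule sum_cyclic_shift) (simp add: f_def p_def per)
  also have "(\<Sum>k<N. 1 / p (Suc k)) = (\<Sum>k<N. 1 / p k)"
    by (rule sum_cyclic_shift[of "\<lambda>k. 1 / p k"]) (simp add: p_def per)
  finally have "2 * sin h * ((\<alpha>\<^sup>2 - \<beta>\<^sup>2 * (cos h)\<^sup>2) * (\<Sum>k<N. 1 / (p k * p (Suc k))))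
      = 2 * sin h * (\<alpha> * (\<Sum>k<N. 1 / p k))" by simp
  then show ?thesis using h by simp
qed

text \<open>
  The real part of \<open>u\<^sub>k\<close> is an affine function of \<open>p\<^sub>k\<close>. The imaginary part of \<open>u\<^sub>k + u\<^sub>k\<^sub>+\<^sub>1\<close> is a
  constant multiple of \<open>p\<^sub>k\<^sub>+\<^sub>1 - p\<^sub>k\<close>, as sum and difference of sine and cosine share the
  factor \<open>sin \<phi>\<close>, so the imaginary parts of the terms telescope.
\<close>

lemma sum_mixed_terms:
  fixes \<alpha> \<beta> R d t :: real and N :: nat
  defines "p \<equiv> \<lambda>k. \<alpha> - \<beta> * cos (vertex_angle N t k)"
    and "u \<equiv> \<lambda>k. of_real R * cis (vertex_angle N t k) - of_real d"
  assumes "N \<ge> 2" and pos: "\<And>k. p k > 0" and "\<beta> \<noteq> 0"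
  shows "(\<Sum>k<N. (u k + u (Suc k)) / of_real (p k * p (Suc k)))
    = of_real (2 * (R * \<alpha> / \<beta> - d) * (\<Sum>k<N. 1 / (p k * p (Suc k)))
        - 2 * R / \<beta> * (\<Sum>k<N. 1 / p k))"
proof -
  define h where "h = pi / real N"
  have h: "sin h > 0"
    using assms(3) unfolding h_def by (intro sin_gt_zero) (auto simp: field_simps)
  have per: "cos (vertex_angle N t N) = cos (vertex_angle N t 0)"
    using cis_vertex_angle_period[of N t] assms(3) by (auto simp: complex_eq_iff)
  have shift: "(\<Sum>k<N. 1 / p (Suc k)) = (\<Sum>k<N. 1 / p k)"
    by (rule sum_cyclic_shift[of "\<lambda>k. 1 / p k"]) (simp add: p_def per)
  have re: "Re ((u k + u (Suc k)) / of_real (p k * p (Suc k)))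
      = 2 * (R * \<alpha> / \<beta> - d) * (1 / (p k * p (Suc k))) - R / \<beta> * (1 / p k + 1 / p (Suc k))" for k
  proof -
    have "Re (u k + u (Suc k)) = 2 * (R * \<alpha> / \<beta> - d) - R / \<beta> * (p k + p (Suc k))"
      using \<open>\<beta> \<noteq> 0\<close> by (simp add: u_def p_def field_simps)
    then show ?thesis
      using pos[of k] pos[of "Suc k"] by (simp add: diff_divide_distrib add_frac_eq)
  qed
  have im: "Im ((u k + u (Suc k)) / of_real (p k * p (Suc k)))
      = R * cos h / (\<beta> * sin h) * (1 / p k - 1 / p (Suc k))" for k
  proof -
    define \<phi> where "\<phi> = vertex_angle N t k + h"
    have x: "vertex_angle N t k = \<phi> - h" "vertex_angle N t (Suc k) = \<phi> + h"
      by (simp_all add: \<phi>_def vertex_angle_Suc h_def)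
    have "Im (u k + u (Suc k)) = R * cos h / (\<beta> * sin h) * (p (Suc k) - p k)"
      using h \<open>\<beta> \<noteq> 0\<close> unfolding u_def p_def x
      by (simp add: sin_add sin_diff cos_add cos_diff field_simps)
    then show ?thesis
      using pos[of k] pos[of "Suc k"] by (simp only: Im_divide_of_real) (simp add: field_simps)
  qed
  show ?thesis
  proof (rule complex_eqI)
    show "Re (\<Sum>k<N. (u k + u (Suc k)) / of_real (p k * p (Suc k)))
      = Re (of_real (2 * (R * \<alpha> / \<beta> - d) * (\<Sum>k<N. 1 / (p k * p (Suc k)))
        - 2 * R / \<beta> * (\<Sum>k<N. 1 / p k)))"
      unfolding Re_sum re sum_subtractf sum_distrib_left[symmetric] sum.distrib shift by simp
    show "Im (\<Sum>k<N. (u k + u (Suc k)) / of_real (p k * p (Suc k)))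
      = Im (of_real (2 * (R * \<alpha> / \<beta> - d) * (\<Sum>k<N. 1 / (p k * p (Suc k)))
        - 2 * R / \<beta> * (\<Sum>k<N. 1 / p k)))"
      unfolding Im_sum im sum_subtractf sum_distrib_left[symmetric] shift by simp
  qed
qed

text \<open>
  The real part of \<open>u\<^sub>k / p\<^sub>k\<^sup>2\<close> is a combination of \<open>1 / p\<^sub>k\<^sup>2\<close> and \<open>1 / p\<^sub>k\<close>, its imaginary part
  a multiple of the sine over \<open>p\<^sub>k\<^sup>2\<close>. Both sums carry the factor \<open>1 / D\<close>, for the
  Poisson denominator \<open>D\<close> with parameter \<open>s\<^sup>N\<close>, and so does \<open>\<Sum> 1 / p\<^sub>k\<close>. Factoring the last sum out
  therefore leaves an affine function of \<open>Re b\<close> and \<open>Im b\<close>.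
\<close>

lemma sum_square_terms:
  fixes \<kappa> s R d t :: real and N :: nat
  defines "\<alpha> \<equiv> \<kappa> * (1 + s\<^sup>2)" and "\<beta> \<equiv> 2 * \<kappa> * s"
  defines "p \<equiv> \<lambda>k. \<alpha> - \<beta> * cos (vertex_angle N t k)"
    and "u \<equiv> \<lambda>k. of_real R * cis (vertex_angle N t k) - of_real d"
    and "b \<equiv> blaschke (s^N) (cis (real N * t))"
  assumes "N > 0" "0 < s" "s < 1" "\<kappa> > 0"
  shows "(\<Sum>k<N. u k / of_real ((p k)\<^sup>2))
    = of_real (\<Sum>k<N. 1 / p k) *
      Complex ((R * \<alpha> / \<beta> - d) * ((1 + s\<^sup>2) / (\<kappa> * (1 - s\<^sup>2)\<^sup>2)
          + 2 * real N * s ^ N / (\<kappa> * (1 - s\<^sup>2) * (1 - (s^N)\<^sup>2)) * Re b) - R / \<beta>)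
        (R * real N * s ^ (N - 1) / (\<kappa> * (1 - (s^N)\<^sup>2)) * Im b)"
proof -
  define n where "n k = poisson_denom s (vertex_angle N t k)" for k
  define D where "D = poisson_denom (s^N) (real N * t)"
  have as: "\<bar>s\<bar> < 1" using assms by simp
  have sN: "\<bar>s ^ N\<bar> < 1" using assms(6) as by (simp add: power_abs power_less_one_iff)
  have n: "n k > 0" for k unfolding n_def by (rule poisson_denom_pos[OF as])
  have D: "D > 0" unfolding D_def by (rule poisson_denom_pos[OF sN])
  have s2: "1 - s\<^sup>2 > 0" using as by (simp add: abs_square_less_1)
  have q2: "1 - (s^N)\<^sup>2 > 0" using sN by (simp only: abs_square_less_1 diff_gt_0_iff_gt)
  have p: "p k = \<kappa> * n k" for k
    by (simp add: p_def \<alpha>_def \<beta>_def n_def poisson_denom_def algebra_simps)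
  have S0: "(\<Sum>k<N. 1 / p k) = real N * (1 - (s^N)\<^sup>2) / (\<kappa> * (1 - s\<^sup>2) * D)"
  proof -
    have "(\<Sum>k<N. 1 / p k) = (\<Sum>k<N. 1 / n k) / \<kappa>"
      by (simp add: p sum_divide_distrib mult.commute)
    then show ?thesis
      unfolding n_def sum_poisson[OF assms(6) as] D_def by (simp add: mult_ac)
  qed
  have B: "(\<Sum>k<N. blaschke s (cis (vertex_angle N t k)) / of_real (n k))
      = of_real ((real N)\<^sup>2 * s ^ (N - 1) / D) * b"
    unfolding n_def D_def b_def by (rule sum_blaschke[OF assms(6) as])
  have Sin_sum: "(\<Sum>k<N. sin (vertex_angle N t k) / (n k)\<^sup>2) = (real N)\<^sup>2 * s ^ (N - 1) / D * Im b / (1 - s\<^sup>2)"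
  proof -
    have "(1 - s\<^sup>2) * (\<Sum>k<N. sin (vertex_angle N t k) / (n k)\<^sup>2)
        = Im (\<Sum>k<N. blaschke s (cis (vertex_angle N t k)) / of_real (n k))"
      unfolding sum_distrib_left n_def sin_over_poisson_denom_squared[OF as] Im_sum ..
    then show ?thesis unfolding B using s2 by (auto simp: eq_divide_eq mult_ac)
  qed
  have Sq: "(\<Sum>k<N. 1 / (p k)\<^sup>2)
      = (2 * s * ((real N)\<^sup>2 * s ^ (N - 1) / D * Re b) + (1 + s\<^sup>2) * \<kappa> * (\<Sum>k<N. 1 / p k))
          / (\<kappa>\<^sup>2 * (1 - s\<^sup>2)\<^sup>2)"
  proof -
    have "(1 - s\<^sup>2)\<^sup>2 * (\<Sum>k<N. 1 / (n k)\<^sup>2)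
        = 2 * s * Re (\<Sum>k<N. blaschke s (cis (vertex_angle N t k)) / of_real (n k))
          + (1 + s\<^sup>2) * (\<Sum>k<N. 1 / n k)"
      unfolding sum_distrib_left n_def Re_sum sum.distrib[symmetric]
      using inverse_poisson_denom_squared[OF as] by simp
    also have "(\<Sum>k<N. 1 / n k) = \<kappa> * (\<Sum>k<N. 1 / p k)"
      using assms(9) by (simp add: p sum_distrib_left)
    finally have "(\<Sum>k<N. 1 / (n k)\<^sup>2)
        = (2 * s * ((real N)\<^sup>2 * s ^ (N - 1) / D * Re b) + (1 + s\<^sup>2) * \<kappa> * (\<Sum>k<N. 1 / p k))
          / (1 - s\<^sup>2)\<^sup>2"
      unfolding B using s2 by (simp add: eq_divide_eq mult_ac)
    moreover have "(\<Sum>k<N. 1 / (p k)\<^sup>2) = (\<Sum>k<N. 1 / (n k)\<^sup>2) / \<kappa>\<^sup>2"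
      by (simp add: p power_mult_distrib sum_divide_distrib mult.commute)
    ultimately show ?thesis by (simp add: mult_ac)
  qed
  have sN_eq: "s ^ N = s * s ^ (N - 1)" using assms(6) by (cases N) auto
  show ?thesis
  proof (rule complex_eqI)
    have "Re (u k / of_real ((p k)\<^sup>2)) = (R * \<alpha> / \<beta> - d) * (1 / (p k)\<^sup>2) - R / \<beta> * (1 / p k)" for k
    proof -
      have "\<beta> \<noteq> 0" using assms by (simp add: \<beta>_def)
      then have "Re (u k) = (R * \<alpha> / \<beta> - d) - R / \<beta> * p k"
        by (simp add: u_def p_def field_simps)
      moreover have "p k > 0" using n[of k] assms(9) unfolding p by simp
      ultimately show ?thesis by (simp only: Re_divide_of_real) (simp add: field_simps power2_eq_square)
    qed
    then have "Re (\<Sum>k<N. u k / of_real ((p k)\<^sup>2))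
        = (R * \<alpha> / \<beta> - d) * (\<Sum>k<N. 1 / (p k)\<^sup>2) - R / \<beta> * (\<Sum>k<N. 1 / p k)"
      by (simp only: Re_sum sum_subtractf sum_distrib_left)
    also have "(\<Sum>k<N. 1 / (p k)\<^sup>2) = (\<Sum>k<N. 1 / p k) * ((1 + s\<^sup>2) / (\<kappa> * (1 - s\<^sup>2)\<^sup>2)
          + 2 * real N * s ^ N / (\<kappa> * (1 - s\<^sup>2) * (1 - (s^N)\<^sup>2)) * Re b)"
    proof -
      have "2 * s * ((real N)\<^sup>2 * s ^ (N - 1) / D * Re b) / (\<kappa>\<^sup>2 * (1 - s\<^sup>2)\<^sup>2)
        = (\<Sum>k<N. 1 / p k) * (2 * real N * s ^ N / (\<kappa> * (1 - s\<^sup>2) * (1 - (s^N)\<^sup>2)) * Re b)"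
        unfolding S0 using s2 q2 D assms(9)
        by (simp add: divide_simps) (simp add: sN_eq power2_eq_square)
      moreover have "(1 + s\<^sup>2) * \<kappa> * S / (\<kappa>\<^sup>2 * (1 - s\<^sup>2)\<^sup>2) = S * ((1 + s\<^sup>2) / (\<kappa> * (1 - s\<^sup>2)\<^sup>2))" for S
        using assms(9) by (simp add: power2_eq_square[of \<kappa>])
      ultimately show ?thesis
        by (simp only: Sq add_divide_distrib distrib_left add.commute)
    qed
    finally show "Re (\<Sum>k<N. u k / of_real ((p k)\<^sup>2)) = Re (of_real (\<Sum>k<N. 1 / p k) *
      Complex ((R * \<alpha> / \<beta> - d) * ((1 + s\<^sup>2) / (\<kappa> * (1 - s\<^sup>2)\<^sup>2)
          + 2 * real N * s ^ N / (\<kappa> * (1 - s\<^sup>2) * (1 - (s^N)\<^sup>2)) * Re b) - R / \<beta>)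
        (R * real N * s ^ (N - 1) / (\<kappa> * (1 - (s^N)\<^sup>2)) * Im b))"
      by (simp add: right_diff_distrib mult.left_commute mult.commute)
    have "Im (\<Sum>k<N. u k / of_real ((p k)\<^sup>2)) = R / \<kappa>\<^sup>2 * (\<Sum>k<N. sin (vertex_angle N t k) / (n k)\<^sup>2)"
      unfolding Im_sum sum_distrib_left
      by (simp only: Im_divide_of_real) (simp add: u_def p power_mult_distrib)
    also have "\<dots> = (\<Sum>k<N. 1 / p k) * (R * real N * s ^ (N - 1) / (\<kappa> * (1 - (s^N)\<^sup>2)) * Im b)"
      unfolding Sin_sum S0 using s2 q2 D assms(9)
      by (simp add: divide_simps) (simp add: power2_eq_square)
    finally show "Im (\<Sum>k<N. u k / of_real ((p k)\<^sup>2)) = Im (of_real (\<Sum>k<N. 1 / p k) *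
      Complex ((R * \<alpha> / \<beta> - d) * ((1 + s\<^sup>2) / (\<kappa> * (1 - s\<^sup>2)\<^sup>2)
          + 2 * real N * s ^ N / (\<kappa> * (1 - s\<^sup>2) * (1 - (s^N)\<^sup>2)) * Re b) - R / \<beta>)
        (R * real N * s ^ (N - 1) / (\<kappa> * (1 - (s^N)\<^sup>2)) * Im b))"
      by simp
  qed
qed

section \<open>The perimeter centroid of a Steiner-Soddy polygon\<close>

text \<open>
  With \<open>c\<^sub>k = u\<^sub>k / p\<^sub>k\<close>, a side contributes \<open>(1 / p\<^sub>k + 1 / p\<^sub>k\<^sub>+\<^sub>1) (c\<^sub>k + c\<^sub>k\<^sub>+\<^sub>1)\<close> up to a
  constant. The two diagonal products have equal sums by cyclic symmetry.
\<close>

lemma perimeter_centroid_inverted_polygon: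
  fixes u :: "nat \<Rightarrow> complex" and p :: "nat \<Rightarrow> real"
  assumes "N > 0" and closed: "u N = u 0" "p N = p 0" and pos: "\<And>k. p k > 0" and "\<sigma> > 0"
    and P: "\<And>k. P k = A + (m / p k) *\<^sub>R u k"
    and side: "\<And>k. dist (P k) (P (Suc k)) = \<sigma> * (1 / p k + 1 / p (Suc k))"
  shows "perimeter_centroid N P = A + of_real (m / 4) *
    ((2 * (\<Sum>k<N. u k / of_real ((p k)\<^sup>2)) + (\<Sum>k<N. (u k + u (Suc k)) / of_real (p k * p (Suc k))))
      / of_real (\<Sum>k<N. 1 / p k))"
    (is "_ = A + _ * (?T / of_real ?S)")
proof -
  have next_vertex: "P (Suc k mod N) = P (Suc k)" if "k < N" for k
    using that closed P by (cases "Suc k = N") auto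
  have "?S > 0" using assms(1) pos by (intro sum_pos) (auto simp: lessThan_empty_iff)
  have shift: "(\<Sum>k<N. 1 / p (Suc k)) = ?S"
    by (rule sum_cyclic_shift[of "\<lambda>k. 1 / p k"]) (simp add: closed)
  have shift2: "(\<Sum>k<N. u (Suc k) / of_real ((p (Suc k))\<^sup>2)) = (\<Sum>k<N. u k / of_real ((p k)\<^sup>2))"
    by (rule sum_cyclic_shift[of "\<lambda>k. u k / of_real ((p k)\<^sup>2)"]) (simp add: closed)
  have weight: "(\<Sum>k<N. dist (P k) (P (Suc k mod N))) = 2 * \<sigma> * ?S"
  proof -
    have "(\<Sum>k<N. dist (P k) (P (Suc k mod N))) = (\<Sum>k<N. \<sigma> * (1 / p k + 1 / p (Suc k)))"
      by (intro sum.cong) (auto simp: next_vertex side)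
    then show ?thesis
      unfolding sum_distrib_left[symmetric] sum.distrib shift by simp
  qed
  have moment: "dist (P k) (P (Suc k mod N)) *\<^sub>R midpoint (P k) (P (Suc k mod N))
      = of_real (\<sigma> * (1 / p k + 1 / p (Suc k))) * A + of_real (\<sigma> * m / 2) *
        (u k / of_real ((p k)\<^sup>2) + u (Suc k) / of_real ((p (Suc k))\<^sup>2)
          + (u k + u (Suc k)) / of_real (p k * p (Suc k)))" if "k < N" for k
  proof -
    define V where "V = u k / of_real (p k) + u (Suc k) / of_real (p (Suc k))"
    define W where "W = 1 / p k + 1 / p (Suc k)"
    have mid: "midpoint (P k) (P (Suc k)) = A + of_real (m / 2) * V"
      unfolding P midpoint_def V_def by (simp add: scaleR_conv_of_real algebra_simps)
    have product: "of_real W * V = u k / of_real ((p k)\<^sup>2) + u (Suc k) / of_real ((p (Suc k))\<^sup>2)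
          + (u k + u (Suc k)) / of_real (p k * p (Suc k))"
      using pos[of k] pos[of "Suc k"] unfolding W_def V_def
      by (simp add: add_divide_distrib power2_eq_square distrib_left distrib_right mult_ac)
    show ?thesis
      unfolding next_vertex[OF that] side mid W_def[symmetric] product[symmetric]
      by (simp add: scaleR_conv_of_real distrib_left mult_ac)
  qed
  have moments: "(\<Sum>k<N. dist (P k) (P (Suc k mod N)) *\<^sub>R midpoint (P k) (P (Suc k mod N)))
      = of_real (2 * \<sigma> * ?S) * A + of_real (\<sigma> * m / 2) * ?T"
  proof -
    have "(\<Sum>k<N. dist (P k) (P (Suc k mod N)) *\<^sub>R midpoint (P k) (P (Suc k mod N)))
      = (\<Sum>k<N. of_real (\<sigma> * (1 / p k + 1 / p (Suc k))) * A + of_real (\<sigma> * m / 2) *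
        (u k / of_real ((p k)\<^sup>2) + u (Suc k) / of_real ((p (Suc k))\<^sup>2)
          + (u k + u (Suc k)) / of_real (p k * p (Suc k))))"
      by (intro sum.cong) (auto simp: moment)
    also have "\<dots> = of_real (\<sigma> * (?S + (\<Sum>k<N. 1 / p (Suc k)))) * A + of_real (\<sigma> * m / 2) *
        ((\<Sum>k<N. u k / of_real ((p k)\<^sup>2)) + (\<Sum>k<N. u (Suc k) / of_real ((p (Suc k))\<^sup>2))
          + (\<Sum>k<N. (u k + u (Suc k)) / of_real (p k * p (Suc k))))"
      unfolding sum.distrib sum_distrib_left[symmetric] sum_distrib_right[symmetric] of_real_sum[symmetric] ..
    finally show ?thesis unfolding shift shift2 by simp
  qed
  have quotient: "(of_real (2 * \<sigma> * S) * A + of_real (\<sigma> * m / 2) * T) /\<^sub>R (2 * \<sigma> * S)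
      = A + of_real (m / 4) * (T / of_real S)" if "S > 0" for S and T :: complex
    using that assms(5) by (simp add: scaleR_conv_of_real field_simps)
  show ?thesis
    unfolding perimeter_centroid_def weight moments by (rule quotient[OF \<open>?S > 0\<close>])
qed

lemma regular_vertex_vertex_angle: "regular_vertex N c R \<theta> k = c + of_real R * cis (vertex_angle N \<theta> k)"
  by (simp add: regular_vertex_def vertex_angle_def)

lemma chain_radius_pos: "N \<ge> 3 \<Longrightarrow> R > 0 \<Longrightarrow> chain_radius N R > 0"
  unfolding chain_radius_def by (intro mult_pos_pos sin_gt_zero) (auto simp: field_simps)

lemma chain_circle_power_pos:
  assumes "R > 0" and r: "r > 0" and "dist A c < R - r \<or> dist A c > R + r"
  shows "(dist (regular_vertex N c R \<theta> k) A)\<^sup>2 - r\<^sup>2 > 0"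
proof -
  have "dist (regular_vertex N c R \<theta> k) c = R"
    using assms(1) by (simp add: regular_vertex_def dist_norm norm_mult)
  then have "dist (regular_vertex N c R \<theta> k) A > r"
    using assms(3) dist_triangle[of "regular_vertex N c R \<theta> k" c A]
      dist_triangle[of A c "regular_vertex N c R \<theta> k"]
    by (auto simp: dist_commute)
  then show ?thesis using r by (simp add: power_strict_mono)
qed

lemma perimeter_centroid_steiner_soddy:
  fixes c A :: complex and R \<rho> \<theta> :: real and N :: nat
  defines "r \<equiv> chain_radius N R"
  defines "u \<equiv> \<lambda>k. regular_vertex N c R \<theta> k - A"
  defines "p \<equiv> \<lambda>k. (norm (u k))\<^sup>2 - r\<^sup>2"
  assumes "N \<ge> 3" "R > 0" "\<rho> > 0" and A: "dist A c < R - r \<or> dist A c > R + r"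
  shows "perimeter_centroid N (steiner_soddy_polygon N c R A \<rho> \<theta>) = A + of_real (\<rho>\<^sup>2 / 4) *
    ((2 * (\<Sum>k<N. u k / of_real ((p k)\<^sup>2)) + (\<Sum>k<N. (u k + u (Suc k)) / of_real (p k * p (Suc k))))
      / of_real (\<Sum>k<N. 1 / p k))"
proof -
  have r: "r > 0" unfolding r_def using assms(4,5) by (rule chain_radius_pos)
  have p: "p k > 0" for k
    using chain_circle_power_pos[OF assms(5) r A, of N \<theta> k] by (simp add: p_def u_def dist_norm)
  have closed: "u N = u 0"
    using cis_vertex_angle_period[of N \<theta>] assms(4) by (simp add: u_def regular_vertex_vertex_angle)
  have P: "steiner_soddy_polygon N c R A \<rho> \<theta> k = A + (\<rho>\<^sup>2 / p k) *\<^sub>R u k" for k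
  proof -
    have "p k = (dist (regular_vertex N c R \<theta> k) A)\<^sup>2 - r\<^sup>2"
      by (simp add: p_def u_def dist_norm)
    then have "steiner_circle N c R A \<rho> \<theta> k = sphere (A + (\<rho>\<^sup>2 / p k) *\<^sub>R u k) (\<rho>\<^sup>2 * r / p k)"
      unfolding steiner_circle_def u_def r_def[symmetric]
      by (rule inversion_image_sphere) (use p r assms(6) in auto)
    moreover have "\<rho>\<^sup>2 * r / p k > 0" using p r assms(6) by simp
    ultimately show ?thesis
      unfolding steiner_soddy_polygon_def by (simp only: circle_center_sphere)
  qed
  show ?thesis
  proof (rule perimeter_centroid_inverted_polygon[where \<sigma> = "\<rho>\<^sup>2 * r"])
    show "N > 0" using assms(4) by simp
    show "\<rho>\<^sup>2 * r > 0" using r assms(6) by simp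
    show "p N = p 0" by (simp add: p_def closed)
    fix k
    have "norm (u k - u (Suc k)) = 2 * r"
      using consecutive_tangent[OF assms(4,5), of c \<theta> k] by (simp add: u_def r_def dist_norm)
    then show "dist (steiner_soddy_polygon N c R A \<rho> \<theta> k) (steiner_soddy_polygon N c R A \<rho> \<theta> (Suc k))
        = \<rho>\<^sup>2 * r * (1 / p k + 1 / p (Suc k))"
      unfolding P using p r by (intro inverted_tangent_circles) (auto simp: p_def)
  qed (use closed p P in auto)
qed

text \<open>
  The parameter \<open>s\<close> is the root in the unit disc of \<open>\<beta> s\<^sup>2 - 2 \<alpha> s + \<beta> = 0\<close>, so that
  \<open>\<alpha> - \<beta> cos x\<close> is \<open>\<kappa>\<close> times a Poisson denominator.
\<close>

lemma poisson_parameters: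
  fixes \<alpha> \<beta> :: real
  assumes "0 < \<beta>" "\<beta> < \<alpha>"
  obtains \<kappa> s where "\<kappa> > 0" "0 < s" "s < 1" "\<alpha> = \<kappa> * (1 + s\<^sup>2)" "\<beta> = 2 * \<kappa> * s"
proof
  define w where "w = sqrt (\<alpha>\<^sup>2 - \<beta>\<^sup>2)"
  have "\<beta>\<^sup>2 < \<alpha>\<^sup>2" using assms by (intro power_strict_mono) auto
  then have w: "w > 0" "w\<^sup>2 = \<alpha>\<^sup>2 - \<beta>\<^sup>2" by (simp_all add: w_def)
  then have pos: "\<alpha> + w > 0" using assms by simp
  show "(\<alpha> + w) / 2 > 0" "0 < \<beta> / (\<alpha> + w)" "\<beta> / (\<alpha> + w) < 1" "\<beta> = 2 * ((\<alpha> + w) / 2) * (\<beta> / (\<alpha> + w))"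
    using pos w assms by (simp_all add: field_simps)
  have "\<beta>\<^sup>2 = (\<alpha> - w) * (\<alpha> + w)" using w(2) by algebra
  then have "(\<beta> / (\<alpha> + w))\<^sup>2 = (\<alpha> - w) / (\<alpha> + w)"
    using pos by (simp add: power_divide) (simp add: power2_eq_square)
  then show "\<alpha> = (\<alpha> + w) / 2 * (1 + (\<beta> / (\<alpha> + w))\<^sup>2)"
    using pos by (simp add: field_simps)
qed

text \<open>
  In the frame with origin \<open>A\<close> and real axis through \<open>c\<close>, the powers are \<open>\<alpha> - \<beta> cos x\<close> at the
  vertex angles \<open>x\<close>, with \<open>\<alpha> > \<beta>\<close> because \<open>\<alpha> - \<beta> = (R - d)\<^sup>2 - r\<^sup>2\<close>. The constant \<open>X\<close> is a multiple of
  \<open>e = R \<alpha> / \<beta> - d\<close>. If \<open>e\<close> were zero, the locus would be a line segment; this happens exactly when \<open>d\<^sup>2 = R\<^sup>2 - r\<^sup>2\<close>,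
  when \<open>A\<close> lies on the circle through the points of tangency of the congruent circles.
\<close>

lemma perimeter_centroid_blaschke:
  fixes c A :: complex and R \<rho> :: real and N :: nat
  defines "r \<equiv> chain_radius N R"
  assumes "N \<ge> 3" "R > 0" "\<rho> > 0" and A: "dist A c < R - r \<or> dist A c > R + r" and "A \<noteq> c"
  obtains M \<tau> X Y q where "X \<noteq> 0" "Y \<noteq> 0" "\<bar>q\<bar> < 1"
    "\<And>\<theta>. perimeter_centroid N (steiner_soddy_polygon N c R A \<rho> \<theta>)
      = M + cis \<tau> * Complex (X * Re (blaschke q (cis (real N * (\<theta> - \<tau>)))))
          (Y * Im (blaschke q (cis (real N * (\<theta> - \<tau>)))))"
proof -
  have r: "r > 0" unfolding r_def using assms(2,3) by (rule chain_radius_pos)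
  define d where "d = dist A c"
  define \<tau> where "\<tau> = Arg (A - c)"
  have d: "d > 0" using assms(6) by (simp add: d_def)
  have Ac: "A - c = cis \<tau> * of_real d"
    using rcis_cmod_Arg[of "A - c"] by (simp add: d_def \<tau>_def rcis_def dist_norm mult.commute)
  define \<alpha> where "\<alpha> = R\<^sup>2 + d\<^sup>2 - r\<^sup>2"
  define \<beta> where "\<beta> = 2 * R * d"
  define h where "h = pi / real N"
  have "\<bar>R - d\<bar> > r" using A by (auto simp: d_def)
  then have "(R - d)\<^sup>2 > r\<^sup>2"
    using r by (metis power2_abs power_strict_mono less_imp_le pos2)
  then have "\<beta> < \<alpha>" by (simp add: \<alpha>_def \<beta>_def power2_diff)
  moreover have "\<beta> > 0" using assms(3) d by (simp add: \<beta>_def)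
  ultimately obtain \<kappa> s where s: "\<kappa> > 0" "0 < s" "s < 1"
    and \<alpha>: "\<alpha> = \<kappa> * (1 + s\<^sup>2)" and \<beta>: "\<beta> = 2 * \<kappa> * s"
    using poisson_parameters by blast
  define e where "e = R * \<alpha> / \<beta> - d"
  have "e \<noteq> 0"
  proof -
    have "R\<^sup>2 - r\<^sup>2 \<noteq> d\<^sup>2"
    proof (cases "d < R - r")
      case True
      then have "d * d < (R - r) * (R - r)" using d by (intro mult_strict_mono) auto
      moreover have "(R - r) * (R - r) < (R + r) * (R - r)"
        using True d r by (intro mult_strict_right_mono) auto
      ultimately show ?thesis by (auto simp: power2_eq_square algebra_simps)
    next
      case False
      then have "R < d" using A r by (auto simp: d_def)
      then have "R\<^sup>2 < d\<^sup>2" using assms(3) by (intro power_strict_mono) auto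
      moreover have "r\<^sup>2 > 0" using r by simp
      ultimately show ?thesis by linarith
    qed
    moreover have "e = (R\<^sup>2 - r\<^sup>2 - d\<^sup>2) / (2 * d)"
      using d assms(3) by (simp add: e_def \<alpha>_def \<beta>_def field_simps power2_eq_square)
    ultimately show ?thesis using d by simp
  qed
  define q where "q = s ^ N"
  have q: "0 < q" "q < 1" using s assms(2) by (auto simp: q_def power_less_one_iff)
  then have q2: "1 - q\<^sup>2 > 0" by (simp add: abs_square_less_1)
  have s2: "1 - s\<^sup>2 > 0" using s by (simp add: abs_square_less_1)
  define g where "g = \<alpha>\<^sup>2 - \<beta>\<^sup>2 * (cos h)\<^sup>2"
  have "g > 0"
  proof -
    have "\<beta>\<^sup>2 * (cos h)\<^sup>2 \<le> \<beta>\<^sup>2 * 1" by (intro mult_left_mono) (auto simp: abs_square_le_1)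
    moreover have "\<beta>\<^sup>2 < \<alpha>\<^sup>2" using \<open>\<beta> < \<alpha>\<close> \<open>\<beta> > 0\<close> by (intro power_strict_mono) auto
    ultimately show ?thesis by (simp add: g_def)
  qed
  define X where "X = 2 * e * (2 * real N * q / (\<kappa> * (1 - s\<^sup>2) * (1 - q\<^sup>2)))"
  define Y where "Y = 2 * (R * real N * s ^ (N - 1) / (\<kappa> * (1 - q\<^sup>2)))"
  define m where "m = 2 * (e * ((1 + s\<^sup>2) / (\<kappa> * (1 - s\<^sup>2)\<^sup>2)) - R / \<beta>) + (2 * e * (\<alpha> / g) - 2 * R / \<beta>)"
  have main: "perimeter_centroid N (steiner_soddy_polygon N c R A \<rho> \<theta>)
      = A + of_real (\<rho>\<^sup>2 / 4) * (cis \<tau> * Complex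
          (m + X * Re (blaschke q (cis (real N * (\<theta> - \<tau>)))))
          (Y * Im (blaschke q (cis (real N * (\<theta> - \<tau>))))))" for \<theta>
  proof -
    define t where "t = \<theta> - \<tau>"
    define b where "b = blaschke q (cis (real N * t))"
    define u where "u k = of_real R * cis (vertex_angle N t k) - of_real d" for k
    define p where "p k = \<alpha> - \<beta> * cos (vertex_angle N t k)" for k
    have u: "regular_vertex N c R \<theta> k - A = cis \<tau> * u k" for k
    proof -
      have "vertex_angle N \<theta> k = \<tau> + vertex_angle N t k" by (simp add: vertex_angle_def t_def)
      then have "regular_vertex N c R \<theta> k - A = of_real R * (cis \<tau> * cis (vertex_angle N t k)) - (A - c)"
        by (simp add: regular_vertex_vertex_angle cis_mult)
      then show ?thesis unfolding Ac by (simp add: u_def algebra_simps)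
    qed
    have p: "(norm (cis \<tau> * u k))\<^sup>2 - r\<^sup>2 = p k" for k
    proof -
      have "(norm (u k))\<^sup>2 = R\<^sup>2 * ((cos (vertex_angle N t k))\<^sup>2 + (sin (vertex_angle N t k))\<^sup>2) + d\<^sup>2 - \<beta> * cos (vertex_angle N t k)"
        unfolding u_def cmod_power2 by (simp add: \<beta>_def power2_eq_square algebra_simps
            del: sin_cos_squared_add sin_cos_squared_add2 sin_cos_squared_add3)
      then show ?thesis by (simp add: norm_mult p_def \<alpha>_def)
    qed
    have pos: "p k > 0" for k
      using chain_circle_power_pos[OF assms(3) r A, of N \<theta> k] unfolding dist_norm u p .
    define S0 where "S0 = (\<Sum>k<N. 1 / p k)"
    have S0: "S0 > 0" unfolding S0_def using assms(2) pos
      by (intro sum_pos) (auto simp: lessThan_empty_iff)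
    have H: "(\<Sum>k<N. 1 / (p k * p (Suc k))) = \<alpha> / g * S0"
      using sum_consecutive_products[of N \<alpha> \<beta> t] pos assms(2) \<open>g > 0\<close>
      by (simp add: p_def g_def h_def S0_def field_simps)
    have mixed: "(\<Sum>k<N. (u k + u (Suc k)) / of_real (p k * p (Suc k)))
        = of_real S0 * of_real (2 * e * (\<alpha> / g) - 2 * R / \<beta>)"
    proof -
      have "(\<Sum>k<N. (u k + u (Suc k)) / of_real (p k * p (Suc k)))
          = of_real (2 * e * (\<Sum>k<N. 1 / (p k * p (Suc k))) - 2 * R / \<beta> * (\<Sum>k<N. 1 / p k))"
        unfolding p_def u_def e_def
        by (rule sum_mixed_terms) (use pos[unfolded p_def] assms(2) \<open>\<beta> > 0\<close> in auto)
      then show ?thesis unfolding H S0_def[symmetric] by (simp add: algebra_simps)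
    qed
    have square: "(\<Sum>k<N. u k / of_real ((p k)\<^sup>2)) = of_real S0 *
        Complex (e * ((1 + s\<^sup>2) / (\<kappa> * (1 - s\<^sup>2)\<^sup>2)
            + 2 * real N * q / (\<kappa> * (1 - s\<^sup>2) * (1 - q\<^sup>2)) * Re b) - R / \<beta>)
          (R * real N * s ^ (N - 1) / (\<kappa> * (1 - q\<^sup>2)) * Im b)"
      unfolding S0_def p_def u_def e_def b_def q_def \<alpha> \<beta>
      by (rule sum_square_terms) (use assms(2) s in auto)
    have "perimeter_centroid N (steiner_soddy_polygon N c R A \<rho> \<theta>) = A + of_real (\<rho>\<^sup>2 / 4) *
      ((2 * (\<Sum>k<N. cis \<tau> * u k / of_real ((p k)\<^sup>2))
        + (\<Sum>k<N. (cis \<tau> * u k + cis \<tau> * u (Suc k)) / of_real (p k * p (Suc k)))) / of_real S0)"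
      using perimeter_centroid_steiner_soddy[OF assms(2-4) A[unfolded r_def], of \<theta>]
      unfolding r_def[symmetric] u p S0_def .
    also have "(2 * (\<Sum>k<N. cis \<tau> * u k / of_real ((p k)\<^sup>2))
        + (\<Sum>k<N. (cis \<tau> * u k + cis \<tau> * u (Suc k)) / of_real (p k * p (Suc k)))) / of_real S0
      = cis \<tau> * ((2 * (\<Sum>k<N. u k / of_real ((p k)\<^sup>2))
        + (\<Sum>k<N. (u k + u (Suc k)) / of_real (p k * p (Suc k)))) / of_real S0)"
      by (simp only: distrib_left[symmetric] sum_distrib_left[symmetric] times_divide_eq_right[symmetric]
          mult.left_commute[of 2])
    also have "(2 * (\<Sum>k<N. u k / of_real ((p k)\<^sup>2))
        + (\<Sum>k<N. (u k + u (Suc k)) / of_real (p k * p (Suc k)))) / of_real S0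
      = Complex (m + X * Re b) (Y * Im b)"
    proof -
      have "2 * (\<Sum>k<N. u k / of_real ((p k)\<^sup>2)) + (\<Sum>k<N. (u k + u (Suc k)) / of_real (p k * p (Suc k)))
        = of_real S0 * Complex (m + X * Re b) (Y * Im b)"
        unfolding square mixed
        by (rule complex_eqI) (simp_all add: m_def X_def Y_def algebra_simps)
      then show ?thesis using S0 by simp
    qed
    finally show ?thesis by (simp add: b_def t_def)
  qed
  show ?thesis
  proof (rule that[of "\<rho>\<^sup>2 / 4 * X" "\<rho>\<^sup>2 / 4 * Y" q "A + of_real (\<rho>\<^sup>2 / 4 * m) * cis \<tau>" \<tau>])
    show "\<rho>\<^sup>2 / 4 * X \<noteq> 0" "\<rho>\<^sup>2 / 4 * Y \<noteq> 0"
      using s s2 q q2 \<open>e \<noteq> 0\<close> assms(2-4) by (auto simp: X_def Y_def)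
    show "\<bar>q\<bar> < 1" using q by simp
    show "perimeter_centroid N (steiner_soddy_polygon N c R A \<rho> \<theta>)
      = A + of_real (\<rho>\<^sup>2 / 4 * m) * cis \<tau>
        + cis \<tau> * Complex (\<rho>\<^sup>2 / 4 * X * Re (blaschke q (cis (real N * (\<theta> - \<tau>)))))
          (\<rho>\<^sup>2 / 4 * Y * Im (blaschke q (cis (real N * (\<theta> - \<tau>)))))" for \<theta>
    proof -
      have "A + of_real k * (cis \<tau> * Complex (m + X * x) (Y * y))
          = A + of_real (k * m) * cis \<tau> + cis \<tau> * Complex (k * X * x) (k * Y * y)" for k x y
        by (rule complex_eqI) (simp_all add: algebra_simps)
      then show ?thesis unfolding main .
    qed
  qed
qed

lemma perimeter_centroid_concentric:
  assumes "N \<ge> 3" "R > 0" "\<rho> > 0"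
    and "dist c c < R - chain_radius N R \<or> dist c c > R + chain_radius N R"
  shows "perimeter_centroid N (steiner_soddy_polygon N c R c \<rho> \<theta>) = c"
proof -
  have z: "(\<Sum>k<N. cis (vertex_angle N \<theta> k)) = 0"
    using sum_vertex_angle_powers[of 1 N \<theta>] assms(1) by simp
  have "(\<Sum>k<N. cis (vertex_angle N \<theta> (Suc k))) = 0"
    using z assms(1) cis_vertex_angle_period[of N \<theta>] by (subst sum_cyclic_shift) auto
  then show ?thesis
    using z perimeter_centroid_steiner_soddy[OF assms]
    by (simp add: regular_vertex_vertex_angle norm_mult sum.distrib
        flip: sum_divide_distrib sum_distrib_left)
qed

section \<open>The locus\<close>

text \<open>
  A Blaschke factor maps the unit circle onto itself; its inverse is the Blaschke factor with
  parameter \<open>- q\<close>.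
\<close>

lemma range_blaschke_cis:
  assumes "\<bar>q\<bar> < 1" "N > 0"
  shows "range (\<lambda>\<theta>. blaschke q (cis (real N * (\<theta> - \<tau>)))) = sphere 0 1"
proof
  have "norm (cis x - of_real q) = norm (1 - of_real q * cis x)" for x
  proof -
    have "cis x - of_real q = cis x * cnj (1 - of_real q * cis x)"
      by (simp add: algebra_simps cis_cnj cis_mult)
    then show ?thesis by (metis complex_mod_cnj mult_1 norm_cis norm_mult)
  qed
  then show "range (\<lambda>\<theta>. blaschke q (cis (real N * (\<theta> - \<tau>)))) \<subseteq> sphere 0 1"
    using one_minus_scaled_cis_nonzero[OF assms(1)] by (auto simp: blaschke_def norm_divide)
  show "sphere 0 1 \<subseteq> range (\<lambda>\<theta>. blaschke q (cis (real N * (\<theta> - \<tau>))))"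
  proof
    fix w :: complex assume "w \<in> sphere 0 1"
    then have w: "w = cis (Arg w)" using rcis_cmod_Arg[of w] by (simp add: rcis_def)
    define z where "z = blaschke (- q) w"
    have nz: "1 + of_real q * w \<noteq> 0"
      using one_minus_scaled_cis_nonzero[of "- q" "Arg w"] assms(1) w by simp
    have "norm (w + of_real q) = norm (1 + of_real q * w)"
    proof -
      have "w + of_real q = w * cnj (1 + of_real q * w)"
        by (subst (1 2 3) w) (simp add: algebra_simps cis_cnj cis_mult)
      then show ?thesis using w by (metis complex_mod_cnj mult_1 norm_cis norm_mult)
    qed
    then have "norm z = 1" using nz by (simp add: z_def blaschke_def norm_divide)
    then have z: "z = cis (Arg z)" using rcis_cmod_Arg[of z] by (simp add: rcis_def)
    have "blaschke q z = w"
    proof -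
      have "z * (1 + of_real q * w) = w + of_real q" using nz by (simp add: z_def blaschke_def)
      then have "z - of_real q = w * (1 - of_real q * z)" by (simp add: algebra_simps)
      moreover have "1 - of_real q * z \<noteq> 0"
        using one_minus_scaled_cis_nonzero[OF assms(1), of "Arg z"] z by simp
      ultimately show ?thesis by (simp add: blaschke_def)
    qed
    moreover have "real N * ((Arg z / real N + \<tau>) - \<tau>) = Arg z" using assms(2) by simp
    ultimately show "w \<in> range (\<lambda>\<theta>. blaschke q (cis (real N * (\<theta> - \<tau>))))"
      using z by (metis rangeI)
  qed
qed

lemma nondegenerate_conic_imp_conic:
  assumes "nondegenerate_conic S"
  shows "conic S"
proof -
  obtain a b d e f g where S: "S = quadratic_curve a b d e f g" "S \<noteq> {}"
    and det: "det (vector [vector [a, b, e], vector [b, d, f], vector [e, f, g]] :: real^3^3) \<noteq> 0"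
    using assms unfolding nondegenerate_conic_def by blast
  have "(a, b, d) \<noteq> (0, 0, 0)" using det by (auto simp: det_3)
  then show ?thesis using S unfolding conic_def by blast
qed

lemma nondegenerate_conic_ellipse:
  assumes "X \<noteq> 0" "Y \<noteq> 0"
  shows "nondegenerate_conic ((\<lambda>w. M + cis \<tau> * Complex (X * Re w) (Y * Im w)) ` sphere 0 1)"
    (is "nondegenerate_conic ?S")
proof -
  define C where "C = cos \<tau>"
  define S where "S = sin \<tau>"
  have CS: "C\<^sup>2 + S\<^sup>2 = 1" by (simp add: C_def S_def)
  \<comment> \<open>coefficients of \<open>Y\<^sup>2 x\<^sup>2 + X\<^sup>2 y\<^sup>2 - X\<^sup>2 Y\<^sup>2\<close> in the coordinates \<open>x\<close>, \<open>y\<close> along the axes of the ellipse\<close>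
  define a where "a = Y\<^sup>2 * C\<^sup>2 + X\<^sup>2 * S\<^sup>2"
  define b where "b = C * S * (Y\<^sup>2 - X\<^sup>2)"
  define d where "d = Y\<^sup>2 * S\<^sup>2 + X\<^sup>2 * C\<^sup>2"
  define e where "e = - (a * Re M + b * Im M)"
  define f where "f = - (b * Re M + d * Im M)"
  define g where "g = a * (Re M)\<^sup>2 + 2 * b * Re M * Im M + d * (Im M)\<^sup>2 - X\<^sup>2 * Y\<^sup>2"
  have "det (vector [vector [a, b, e], vector [b, d, f], vector [e, f, g]] :: real^3^3) = - (X^4 * Y^4)"
  proof -
    have "a * d - b\<^sup>2 = X\<^sup>2 * Y\<^sup>2"
      unfolding a_def b_def d_def using CS by algebra
    moreover have "det (vector [vector [a, b, e], vector [b, d, f], vector [e, f, g]] :: real^3^3)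
        = - (X\<^sup>2 * Y\<^sup>2) * (a * d - b\<^sup>2)"
      unfolding e_def f_def g_def by (simp add: det_3 power2_eq_square algebra_simps)
    ultimately show ?thesis by (simp add: power2_eq_square power4_eq_xxxx)
  qed
  then have det: "det (vector [vector [a, b, e], vector [b, d, f], vector [e, f, g]] :: real^3^3) \<noteq> 0"
    using assms by simp
  have form: "a * (Re z)\<^sup>2 + 2 * b * Re z * Im z + d * (Im z)\<^sup>2 + 2 * e * Re z + 2 * f * Im z + g
      = Y\<^sup>2 * ((Re z - Re M) * C + (Im z - Im M) * S)\<^sup>2
        + X\<^sup>2 * ((Im z - Im M) * C - (Re z - Re M) * S)\<^sup>2 - X\<^sup>2 * Y\<^sup>2" for z
    unfolding a_def b_def d_def e_def f_def g_def by algebra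
  have "?S = quadratic_curve a b d e f g"
  proof
    show "?S \<subseteq> quadratic_curve a b d e f g"
    proof
      fix z assume "z \<in> ?S"
      then obtain w where w: "norm w = 1" and z: "z = M + cis \<tau> * Complex (X * Re w) (Y * Im w)"
        by auto
      have "(Re w)\<^sup>2 + (Im w)\<^sup>2 = 1" using w cmod_power2[of w] by simp
      moreover have "Re z - Re M = C * (X * Re w) - S * (Y * Im w)"
          "Im z - Im M = C * (Y * Im w) + S * (X * Re w)"
        unfolding z C_def S_def by simp_all
      ultimately show "z \<in> quadratic_curve a b d e f g"
        unfolding quadratic_curve_def mem_Collect_eq form using CS by algebra
    qed
    show "quadratic_curve a b d e f g \<subseteq> ?S"
    proof
      fix z assume "z \<in> quadratic_curve a b d e f g"
      then have eq: "Y\<^sup>2 * ((Re z - Re M) * C + (Im z - Im M) * S)\<^sup>2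
        + X\<^sup>2 * ((Im z - Im M) * C - (Re z - Re M) * S)\<^sup>2 = X\<^sup>2 * Y\<^sup>2"
        unfolding quadratic_curve_def mem_Collect_eq form by simp
      define x y where "x = (Re z - Re M) * C + (Im z - Im M) * S"
        and "y = (Im z - Im M) * C - (Re z - Re M) * S"
      define w where "w = Complex (x / X) (y / Y)"
      have "Y\<^sup>2 * x\<^sup>2 + X\<^sup>2 * y\<^sup>2 = X\<^sup>2 * Y\<^sup>2" using eq by (simp add: x_def y_def)
      then have "(x / X)\<^sup>2 + (y / Y)\<^sup>2 = 1"
        using assms by (simp add: field_simps)
      then have "norm w = 1" by (simp add: w_def cmod_def)
      moreover have "z = M + cis \<tau> * Complex (X * Re w) (Y * Im w)"
      proof (rule complex_eqI)
        have "Re z - Re M = C * x - S * y" "Im z - Im M = C * y + S * x"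
          unfolding x_def y_def using CS by algebra+
        then show "Re z = Re (M + cis \<tau> * Complex (X * Re w) (Y * Im w))"
          "Im z = Im (M + cis \<tau> * Complex (X * Re w) (Y * Im w))"
          using assms by (simp_all add: w_def C_def S_def)
      qed
      ultimately show "z \<in> ?S" by auto
    qed
  qed
  moreover have "?S \<noteq> {}" by (simp add: sphere_eq_empty)
  ultimately show ?thesis unfolding nondegenerate_conic_def using det by blast
qed

lemma conic_singleton: "conic {A}"
proof -
  have "{A} = quadratic_curve 1 0 1 (- Re A) (- Im A) ((Re A)\<^sup>2 + (Im A)\<^sup>2)"
  proof -
    have "1 * (Re z)\<^sup>2 + 2 * 0 * Re z * Im z + 1 * (Im z)\<^sup>2 + 2 * (- Re A) * Re z + 2 * (- Im A) * Im z
        + ((Re A)\<^sup>2 + (Im A)\<^sup>2) = (Re z - Re A)\<^sup>2 + (Im z - Im A)\<^sup>2" for z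
      by (simp add: power2_eq_square algebra_simps)
    then show ?thesis
      unfolding quadratic_curve_def by (auto simp: sum_power2_eq_zero_iff complex_eq_iff)
  qed
  then show ?thesis unfolding conic_def by (metis insert_not_empty prod.inject zero_neq_one)
qed

theorem corollary2:
  fixes N :: nat and c A :: complex and R \<rho> :: real
  assumes "N \<ge> 3" and "R > 0" and "\<rho> > 0"
    and "dist A c < R - chain_radius N R \<or> dist A c > R + chain_radius N R"
  shows "conic (perimeter_centroid_locus N c R A \<rho>) \<and>
    (A \<noteq> c \<longrightarrow> nondegenerate_conic (perimeter_centroid_locus N c R A \<rho>))"
proof (cases "A = c")
  case True
  have "perimeter_centroid_locus N c R A \<rho> = {c}"
    using perimeter_centroid_concentric assms unfolding perimeter_centroid_locus_def True by auto
  then show ?thesis using True conic_singleton by simp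
next
  case False
  obtain M \<tau> X Y q where XY: "X \<noteq> 0" "Y \<noteq> 0" and q: "\<bar>q\<bar> < 1"
    and centroid: "\<And>\<theta>. perimeter_centroid N (steiner_soddy_polygon N c R A \<rho> \<theta>)
      = M + cis \<tau> * Complex (X * Re (blaschke q (cis (real N * (\<theta> - \<tau>)))))
          (Y * Im (blaschke q (cis (real N * (\<theta> - \<tau>)))))"
    by (rule perimeter_centroid_blaschke[OF assms False]) blast
  have "perimeter_centroid_locus N c R A \<rho>
      = (\<lambda>w. M + cis \<tau> * Complex (X * Re w) (Y * Im w)) `
          range (\<lambda>\<theta>. blaschke q (cis (real N * (\<theta> - \<tau>))))"
    unfolding perimeter_centroid_locus_def centroid by (simp add: image_image)
  also have "range (\<lambda>\<theta>. blaschke q (cis (real N * (\<theta> - \<tau>)))) = sphere 0 1"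
    using assms(1) by (intro range_blaschke_cis[OF q]) simp
  finally have "nondegenerate_conic (perimeter_centroid_locus N c R A \<rho>)"
    using nondegenerate_conic_ellipse[OF XY] by simp
  then show ?thesis using nondegenerate_conic_imp_conic by simp
qed

end
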